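(* Let $\Gamma$ be a set of infons and $\varphi$ an infon. Then $\Gamma\vdash\varphi$ in the primal infon logic $\mathbf{P}$ if and only if $v(\varphi)\in M$ for every model $\langle I,M\rangle$ (with $I=\langle\mathcal A,v\rangle$ ranging over all interpretations and $M$ over all closed sets of $\mathcal A$) such that $v(\Gamma)\subseteq M$.
   Context: Infons: fix a set $At$ of atomic infons; infons are generated by $\varphi ::= \top \mid At \mid (\varphi\wedge\varphi)\mid(\varphi\to\varphi)$ (the arrow is "primal implication"). Derivability in $\mathbf{P}$: $\Gamma\vdash\varphi$ iff there is a finite sequence $\varphi_1,\dots,\varphi_n=\varphi$ where each $\varphi_k$ is in $\Gamma\cup\{\top\}$ or follows from earlier members by one of the rules: from $\varphi_1,\varphi_2$ infer $\varphi_1\wedge\varphi_2$; from $\varphi_1\wedge\varphi_2$ infer $\varphi_i$ ($i=1,2$); from $\varphi_2$ infer $\varphi_1\to\varphi_2$ (for any $\varphi_1$); from $\varphi_1$ and $\varphi_1\to\varphi_2$ infer $\varphi_2$. Infon algebra: $\Sigma=\{0,1\}$, $\Sigma^*$ the set of binary strings; $\mathcal A=\langle\Sigma^*,\pi,l,r,\mathrm{enc},\mathrm{dec},E\rangle$ where $\pi,\mathrm{enc}:(\Sigma^* )^2\to\Sigma^*$ are total, $l,r:\Sigma^*\to\Sigma^*$ and $\mathrm{dec}:(\Sigma^* )^2\to\Sigma^*$ are partial, with $l(\pi(x,y))=x$, $r(\pi(x,y))=y$, $\mathrm{dec}(x,\mathrm{enc}(x,y))=y$ defined and valid for all $x,y\in\Sigma^*$,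 and $\emptyset\neq E\subseteq\Sigma^*$. A set $M\subseteq\Sigma^*$ is closed if $E\subseteq M$ and for all $a,b\in\Sigma^*$: (1) $a,b\in M\iff\pi(a,b)\in M$; (2) $a\in M$ and $\mathrm{enc}(a,b)\in M$ imply $b\in M$; (3) $b\in M$ implies $\mathrm{enc}(a,b)\in M$. An interpretation is $I=\langle\mathcal A,v\rangle$ with $\mathcal A$ an infon algebra and $v:At\cup\{\top\}\to\Sigma^*$ total with $v(\top)\in E$, extended by $v(\varphi_1\wedge\varphi_2)=\pi(v(\varphi_1),v(\varphi_2))$, $v(\varphi_1\to\varphi_2)=\mathrm{enc}(v(\varphi_1),v(\varphi_2))$, $v(\Gamma)=\{v(\varphi):\varphi\in\Gamma\}$. A model is a pair $\langle I,M\rangle$ with $I$ an interpretation and $M$ a closed set.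
   Formalization: The set At of atomic infons is assumed countable (finite or empty allowed); for uncountable At the completeness direction fails, because valuations take values in the countable set of binary strings and must identify distinct atoms. *)

theory Defs
  imports "HOL-Library.Countable_Set"
begin

datatype (atoms: 'a) infon =
    Top
  | Atom 'a
  | Conj "'a infon" "'a infon"
  | Imp "'a infon" "'a infon"

text \<open>The atoms form an explicit carrier set, so that every set of atoms, including the empty
  one, is covered.\<close>

definition infons :: "'a set \<Rightarrow> 'a infon set" where
  "infons At = {\<phi>. atoms \<phi> \<subseteq> At}"

definition justified :: "'a infon set \<Rightarrow> 'a infon set \<Rightarrow> 'a infon \<Rightarrow> bool" where
  "justified \<Gamma> X \<psi> \<longleftrightarrow>
     \<psi> \<in> \<Gamma> \<union> {Top} \<or>
     (\<exists>\<phi>1\<in>X. \<exists>\<phi>2\<in>X. \<psi> = Conj \<phi>1 \<phi>2) \<or>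
     (\<exists>\<chi>. Conj \<psi> \<chi> \<in> X) \<or>
     (\<exists>\<chi>. Conj \<chi> \<psi> \<in> X) \<or>
     (\<exists>\<phi>1. \<exists>\<phi>2\<in>X. \<psi> = Imp \<phi>1 \<phi>2) \<or>
     (\<exists>\<phi>1\<in>X. Imp \<phi>1 \<psi> \<in> X)"

text \<open>The rule inferring \<open>Imp \<phi>1 \<phi>2\<close> from \<open>\<phi>2\<close> introduces an
  arbitrary \<open>\<phi>1\<close>; requiring all members of the sequence to lie in \<open>infons At\<close>
  confines it to infons over \<open>At\<close>.\<close>

definition derivation :: "'a set \<Rightarrow> 'a infon set \<Rightarrow> 'a infon list \<Rightarrow> bool" where
  "derivation At \<Gamma> \<phi>s \<longleftrightarrow>
     set \<phi>s \<subseteq> infons At \<and>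
     (\<forall>k<length \<phi>s. justified \<Gamma> (set (take k \<phi>s)) (\<phi>s ! k))"

definition derivable :: "'a set \<Rightarrow> 'a infon set \<Rightarrow> 'a infon \<Rightarrow> bool" where
  "derivable At \<Gamma> \<phi> \<longleftrightarrow>
     (\<exists>\<phi>s. \<phi>s \<noteq> [] \<and> derivation At \<Gamma> \<phi>s \<and> last \<phi>s = \<phi>)"

type_synonym bitstring = "bool list"

text \<open>Partial operations return \<open>None\<close> where they are undefined.\<close>

record infon_structure =
  pair_op :: "bitstring \<Rightarrow> bitstring \<Rightarrow> bitstring"
  left_op :: "bitstring \<Rightarrow> bitstring option"
  right_op :: "bitstring \<Rightarrow> bitstring option"
  enc_op :: "bitstring \<Rightarrow> bitstring \<Rightarrow> bitstring"
  dec_op :: "bitstring \<Rightarrow> bitstring \<Rightarrow> bitstring option"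
  known :: "bitstring set" \<comment> \<open>the set \<open>E\<close>\<close>

definition infon_algebra :: "infon_structure \<Rightarrow> bool" where
  "infon_algebra A \<longleftrightarrow>
     (\<forall>x y. left_op A (pair_op A x y) = Some x) \<and>
     (\<forall>x y. right_op A (pair_op A x y) = Some y) \<and>
     (\<forall>x y. dec_op A x (enc_op A x y) = Some y) \<and>
     known A \<noteq> {}"

definition closed_in :: "infon_structure \<Rightarrow> bitstring set \<Rightarrow> bool" where
  "closed_in A M \<longleftrightarrow>
     known A \<subseteq> M \<and>
     (\<forall>a b. a \<in> M \<and> b \<in> M \<longleftrightarrow> pair_op A a b \<in> M) \<and>
     (\<forall>a b. a \<in> M \<and> enc_op A a b \<in> M \<longrightarrow> b \<in> M) \<and>
     (\<forall>a b. b \<in> M \<longrightarrow> enc_op A a b \<in> M)"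

text \<open>The valuation of \<open>At \<union> {\<top>}\<close> is split into its value at \<open>\<top>\<close> and its
  values at the atoms. The values of \<open>val_atom\<close> outside \<open>At\<close> are never used when
  evaluating elements of \<open>infons At\<close>.\<close>

record 'a interp =
  alg :: infon_structure
  val_top :: bitstring
  val_atom :: "'a \<Rightarrow> bitstring"

definition interpretation_of_infons :: "'a interp \<Rightarrow> bool" where
  "interpretation_of_infons I \<longleftrightarrow>
     infon_algebra (alg I) \<and> val_top I \<in> known (alg I)"

primrec val :: "'a interp \<Rightarrow> 'a infon \<Rightarrow> bitstring" where
  "val I Top = val_top I"
| "val I (Atom p) = val_atom I p"
| "val I (Conj \<phi>1 \<phi>2) = pair_op (alg I) (val I \<phi>1) (val I \<phi>2)"
| "val I (Imp \<phi>1 \<phi>2) = enc_op (alg I) (val I \<phi>1) (val I \<phi>2)"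

definition is_model :: "'a interp \<Rightarrow> bitstring set \<Rightarrow> bool" where
  "is_model I M \<longleftrightarrow> interpretation_of_infons I \<and> closed_in (alg I) M"

end

theory Submission imports Defs begin

text \<open>Soundness is an induction along a derivation. For completeness, strings are identified with
  the infons over countably many atoms by a bijection, so that \<open>\<pi>\<close> and
  \<open>enc\<close> become the constructors \<open>Conj\<close> and \<open>Imp\<close>. Reading a
  string as an infon over \<open>At\<close>, with the superfluous atoms read as \<open>\<top>\<close>, the
  strings that denote consequences of \<open>\<Gamma>\<close> form a closed set, because the closure conditions
  mirror the rules. In the resulting model every infon over \<open>At\<close> evaluates to a string
  denoting that infon.\<close>

instance infon :: (countable) countable
  by countable_datatype

text \<open>Both types are countably infinite, so enumerating one and reading off the other at the
  same index is a bijection. Atoms in \<open>nat\<close> make it independent of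
  \<open>At\<close>.\<close>

lemma ex_bij_infon_bitstring: "\<exists>g :: nat infon \<Rightarrow> bitstring. bij g"
proof -
  have "inj (Atom :: nat \<Rightarrow> nat infon)"
    by (simp add: inj_def)
  then have "infinite (UNIV :: nat infon set)"
    by (meson infinite_UNIV_nat finite_imageD finite_subset subset_UNIV)
  then have 1: "bij (to_nat_on (UNIV :: nat infon set))"
    by (intro to_nat_on_infinite) auto
  have "bij_betw (from_nat_into (UNIV :: bitstring set)) UNIV UNIV"
    by (intro bij_betw_from_nat_into) (auto simp: infinite_UNIV_listI)
  with 1 have "bij (from_nat_into (UNIV :: bitstring set) \<circ> to_nat_on (UNIV :: nat infon set))"
    by (rule bij_comp)
  then show ?thesis by (intro exI)
qed

lemma infons_simps [simp]:
  "Top \<in> infons At"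
  "Atom p \<in> infons At \<longleftrightarrow> p \<in> At"
  "Conj \<phi> \<psi> \<in> infons At \<longleftrightarrow> \<phi> \<in> infons At \<and> \<psi> \<in> infons At"
  "Imp \<phi> \<psi> \<in> infons At \<longleftrightarrow> \<phi> \<in> infons At \<and> \<psi> \<in> infons At"
  by (auto simp: infons_def)

lemma justified_mono: "justified \<Gamma> X \<psi> \<Longrightarrow> X \<subseteq> Y \<Longrightarrow> justified \<Gamma> Y \<psi>"
  unfolding justified_def by blast

text \<open>Entries of the second sequence keep their justification because a longer prefix only
  adds available premises.\<close>

lemma derivation_append:
  assumes "derivation At \<Gamma> \<phi>s" "derivation At \<Gamma> \<psi>s"
  shows "derivation At \<Gamma> (\<phi>s @ \<psi>s)"
  unfolding derivation_def
proof (intro conjI allI impI)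
  show "set (\<phi>s @ \<psi>s) \<subseteq> infons At"
    using assms by (auto simp: derivation_def)
next
  fix k assume k: "k < length (\<phi>s @ \<psi>s)"
  show "justified \<Gamma> (set (take k (\<phi>s @ \<psi>s))) ((\<phi>s @ \<psi>s) ! k)"
  proof (cases "k < length \<phi>s")
    case True
    then show ?thesis
      using assms(1) by (simp add: derivation_def nth_append)
  next
    case False
    with k have "justified \<Gamma> (set (take (k - length \<phi>s) \<psi>s)) (\<psi>s ! (k - length \<phi>s))"
      using assms(2) by (simp add: derivation_def)
    then show ?thesis
      using False by (auto simp: nth_append elim: justified_mono)
  qed
qed

lemma derivation_snoc:
  assumes "derivation At \<Gamma> \<phi>s" "justified \<Gamma> (set \<phi>s) \<psi>" "\<psi> \<in> infons At"
  shows "derivation At \<Gamma> (\<phi>s @ [\<psi>])"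
  using assms by (auto simp: derivation_def nth_append less_Suc_eq)

lemma derivable_in_infons: "derivable At \<Gamma> \<phi> \<Longrightarrow> \<phi> \<in> infons At"
  unfolding derivable_def derivation_def by (metis last_in_set subsetD)

text \<open>Conjunction introduction and modus ponens take two premises, each with a derivation of
  its own; concatenation puts them into one sequence.\<close>

lemma derivation_covering:
  assumes "finite X" "\<And>\<chi>. \<chi> \<in> X \<Longrightarrow> derivable At \<Gamma> \<chi>"
  shows "\<exists>\<phi>s. derivation At \<Gamma> \<phi>s \<and> X \<subseteq> set \<phi>s"
  using assms
proof (induction X rule: finite_induct)
  case empty
  have "derivation At \<Gamma> []"
    by (simp add: derivation_def)
  then show ?case by auto
next
  case (insert \<chi> X)
  obtain \<phi>s where \<phi>s: "derivation At \<Gamma> \<phi>s" "X \<subseteq> set \<phi>s"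
    using insert by auto
  obtain \<psi>s where \<psi>s: "derivation At \<Gamma> \<psi>s" "\<chi> \<in> set \<psi>s"
    using insert.prems[of \<chi>] unfolding derivable_def by (metis insertI1 last_in_set)
  have "derivation At \<Gamma> (\<phi>s @ \<psi>s) \<and> insert \<chi> X \<subseteq> set (\<phi>s @ \<psi>s)"
    using \<phi>s \<psi>s by (auto intro: derivation_append)
  then show ?case ..
qed

text \<open>This turns the definition by sequences into closure under the rules. The facts below are
  instances in which \<open>X\<close> is the set of premises of one rule.\<close>

lemma derivable_if_justified:
  assumes "justified \<Gamma> X \<psi>" "finite X" "\<And>\<chi>. \<chi> \<in> X \<Longrightarrow> derivable At \<Gamma> \<chi>" "\<psi> \<in> infons At"
  shows "derivable At \<Gamma> \<psi>"
proof -
  obtain \<phi>s where "derivation At \<Gamma> \<phi>s" "X \<subseteq> set \<phi>s"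
    using derivation_covering[of X] assms by blast
  then have "derivation At \<Gamma> (\<phi>s @ [\<psi>])"
    using assms by (intro derivation_snoc) (auto elim: justified_mono)
  then show ?thesis
    unfolding derivable_def by (intro exI[of _ "\<phi>s @ [\<psi>]"]) simp
qed

lemma derivable_Top: "derivable At \<Gamma> Top"
  by (rule derivable_if_justified[of _ "{}"]) (auto simp: justified_def)

lemma derivable_assumption: "\<phi> \<in> \<Gamma> \<Longrightarrow> \<phi> \<in> infons At \<Longrightarrow> derivable At \<Gamma> \<phi>"
  by (rule derivable_if_justified[of _ "{}"]) (auto simp: justified_def)

lemma derivable_Conj_iff:
  "derivable At \<Gamma> (Conj \<phi> \<psi>) \<longleftrightarrow> derivable At \<Gamma> \<phi> \<and> derivable At \<Gamma> \<psi>"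
proof (intro iffI conjI)
  assume *: "derivable At \<Gamma> (Conj \<phi> \<psi>)"
  then have "\<phi> \<in> infons At" "\<psi> \<in> infons At"
    using derivable_in_infons by fastforce+
  with * show "derivable At \<Gamma> \<phi>" "derivable At \<Gamma> \<psi>"
    by - (rule derivable_if_justified[of _ "{Conj \<phi> \<psi>}"], auto simp: justified_def)+
next
  assume "derivable At \<Gamma> \<phi> \<and> derivable At \<Gamma> \<psi>"
  then show "derivable At \<Gamma> (Conj \<phi> \<psi>)"
    by - (rule derivable_if_justified[of _ "{\<phi>, \<psi>}"],
      auto simp: justified_def dest: derivable_in_infons)
qed

text \<open>The antecedent occurs in no premise, so its membership in \<open>infons At\<close> has
  to be assumed separately.\<close>

lemma derivable_Imp_intro:
  "derivable At \<Gamma> \<psi> \<Longrightarrow> \<phi> \<in> infons At \<Longrightarrow> derivable At \<Gamma> (Imp \<phi> \<psi>)"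
  by (rule derivable_if_justified[of _ "{\<psi>}"])
    (auto simp: justified_def dest: derivable_in_infons)

lemma derivable_mp:
  "derivable At \<Gamma> \<phi> \<Longrightarrow> derivable At \<Gamma> (Imp \<phi> \<psi>) \<Longrightarrow> derivable At \<Gamma> \<psi>"
  using derivable_in_infons[of At \<Gamma> "Imp \<phi> \<psi>"]
  by - (rule derivable_if_justified[of _ "{\<phi>, Imp \<phi> \<psi>}"], auto simp: justified_def)

text \<open>Each rule is matched by one closure condition; both conjunction eliminations come from
  the backward direction of the condition on \<open>pair_op\<close>.\<close>

lemma closed_in_justified:
  assumes "is_model I M" "val I ` \<Gamma> \<subseteq> M" "val I ` X \<subseteq> M" "justified \<Gamma> X \<psi>"
  shows "val I \<psi> \<in> M"
proof -
  have M: "val_top I \<in> M"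
    "pair_op (alg I) a b \<in> M \<longleftrightarrow> a \<in> M \<and> b \<in> M"
    "a \<in> M \<Longrightarrow> enc_op (alg I) a b \<in> M \<Longrightarrow> b \<in> M"
    "b \<in> M \<Longrightarrow> enc_op (alg I) a b \<in> M" for a b
    using assms(1) unfolding is_model_def interpretation_of_infons_def closed_in_def by blast+
  have X: "\<chi> \<in> X \<Longrightarrow> val I \<chi> \<in> M" for \<chi>
    using assms(3) by auto
  consider "\<psi> \<in> \<Gamma>" | "\<psi> = Top"
    | \<phi>1 \<phi>2 where "\<phi>1 \<in> X" "\<phi>2 \<in> X" "\<psi> = Conj \<phi>1 \<phi>2"
    | \<chi> where "Conj \<psi> \<chi> \<in> X"
    | \<chi> where "Conj \<chi> \<psi> \<in> X"
    | \<phi>1 \<phi>2 where "\<phi>2 \<in> X" "\<psi> = Imp \<phi>1 \<phi>2"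
    | \<phi>1 where "\<phi>1 \<in> X" "Imp \<phi>1 \<psi> \<in> X"
    using assms(4) unfolding justified_def by blast
  then show ?thesis
  proof cases
    case 1
    then show ?thesis using assms(2) by blast
  next
    \<comment> \<open>Modus ponens: the value of the antecedent does not occur in the conclusion of
      \<open>M(3)\<close>, so it is supplied explicitly.\<close>
    case 7
    then show ?thesis using X[of "Imp \<phi>1 \<psi>"] X[of \<phi>1] M(3)[of "val I \<phi>1" "val I \<psi>"] by simp
  qed (auto dest!: X simp: M(1,2,4))
qed

lemma soundness:
  assumes "derivable At \<Gamma> \<phi>" "is_model I M" "val I ` \<Gamma> \<subseteq> M"
  shows "val I \<phi> \<in> M"
proof -
  obtain \<phi>s where \<phi>s: "\<phi>s \<noteq> []" "derivation At \<Gamma> \<phi>s" "last \<phi>s = \<phi>"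
    using assms(1) by (auto simp: derivable_def)
  \<comment> \<open>Strong induction on positions: the premises of entry \<open>k\<close> lie in
    \<open>take k \<phi>s\<close>, hence at smaller positions.\<close>
  have "k < length \<phi>s \<Longrightarrow> val I (\<phi>s ! k) \<in> M" for k
  proof (induction k rule: less_induct)
    case (less k)
    then have "val I ` set (take k \<phi>s) \<subseteq> M"
      by (auto simp: in_set_conv_nth)
    moreover have "justified \<Gamma> (set (take k \<phi>s)) (\<phi>s ! k)"
      using \<phi>s(2) less.prems by (simp add: derivation_def)
    ultimately show ?case
      using closed_in_justified assms by blast
  qed
  then show ?thesis
    using \<phi>s by (metis diff_less last_conv_nth length_greater_0_conv zero_less_one)
qed

text \<open>A left inverse, on infons over a countable \<open>At\<close>, of renaming atoms by
  \<open>to_nat_on At\<close>, made total by the default \<open>Top\<close>. If \<open>At\<close> is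
  empty, every atom gets this default.\<close>

primrec decode_atoms :: "'a set \<Rightarrow> nat infon \<Rightarrow> 'a infon" where
  "decode_atoms At Top = Top"
| "decode_atoms At (Atom n) =
    (if n \<in> to_nat_on At ` At then Atom (from_nat_into At n) else Top)"
| "decode_atoms At (Conj \<phi> \<psi>) = Conj (decode_atoms At \<phi>) (decode_atoms At \<psi>)"
| "decode_atoms At (Imp \<phi> \<psi>) = Imp (decode_atoms At \<phi>) (decode_atoms At \<psi>)"

text \<open>In the atom case the test on \<open>n\<close> guarantees that \<open>At\<close> is
  nonempty, which \<open>from_nat_into\<close> requires in order to return an element of
  \<open>At\<close>.\<close>

lemma decode_atoms_in_infons: "decode_atoms At \<phi> \<in> infons At"
  by (induction \<phi>) (auto intro: from_nat_into)

lemma completeness: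
  fixes At :: "'a set"
  assumes "countable At" "\<Gamma> \<subseteq> infons At" "\<phi> \<in> infons At"
    and valid: "\<And>(I :: 'a interp) M. is_model I M \<Longrightarrow> val I ` \<Gamma> \<subseteq> M \<Longrightarrow> val I \<phi> \<in> M"
  shows "derivable At \<Gamma> \<phi>"
proof -
  obtain g :: "nat infon \<Rightarrow> bitstring" where "bij g"
    using ex_bij_infon_bitstring by blast
  define h where "h = inv g"
  have hg [simp]: "h (g x) = x" for x
    using \<open>bij g\<close> by (simp add: h_def bij_is_inj)
  have gh [simp]: "g (h x) = x" for x
    using \<open>bij g\<close> by (simp add: h_def bij_is_surj surj_f_inv_f)
  define s where "s = decode_atoms At \<circ> h"
  \<comment> \<open>The partial operations are defined exactly on strings whose infon has the right
    outermost constructor. \<open>dec_op\<close> ignores its key, which is compatible with the law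
    for decoding.\<close>
  define A where "A =
    \<lparr>pair_op = \<lambda>x y. g (Conj (h x) (h y)),
     left_op = \<lambda>z. case h z of Conj \<alpha> \<beta> \<Rightarrow> Some (g \<alpha>) | _ \<Rightarrow> None,
     right_op = \<lambda>z. case h z of Conj \<alpha> \<beta> \<Rightarrow> Some (g \<beta>) | _ \<Rightarrow> None,
     enc_op = \<lambda>x y. g (Imp (h x) (h y)),
     dec_op = \<lambda>x z. case h z of Imp \<alpha> \<beta> \<Rightarrow> Some (g \<beta>) | _ \<Rightarrow> None,
     known = {g Top}\<rparr>"
  define I :: "'a interp" where
    "I = \<lparr>alg = A, val_top = g Top, val_atom = \<lambda>p. g (Atom (to_nat_on At p))\<rparr>"
  \<comment> \<open>Since \<open>s\<close> sends \<open>pair_op\<close> and \<open>enc_op\<close> to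
    \<open>Conj\<close> and \<open>Imp\<close>, each closure condition for this preimage is a fact
    about \<open>derivable\<close>.\<close>
  define M where "M = {x. derivable At \<Gamma> (s x)}"
  have "infon_algebra A"
    by (simp add: infon_algebra_def A_def)
  moreover have "closed_in A M"
    unfolding closed_in_def
  proof (intro conjI allI impI)
    show "b \<in> M" if "a \<in> M \<and> enc_op A a b \<in> M" for a b
      using that derivable_mp[of At \<Gamma> "s a" "s b"] by (simp add: A_def M_def s_def)
  qed (simp_all add: A_def M_def s_def derivable_Top derivable_Conj_iff
        derivable_Imp_intro decode_atoms_in_infons)
  ultimately have model: "is_model I M"
    by (simp add: is_model_def interpretation_of_infons_def I_def A_def)
  \<comment> \<open>Countability of \<open>At\<close> enters in the atom case, where
    \<open>from_nat_into At\<close> must undo \<open>to_nat_on At\<close>. Consequently, for infons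
    over \<open>At\<close>, having a value in \<open>M\<close> is the same as being derivable from
    \<open>\<Gamma>\<close>.\<close>
  have s_val: "s (val I \<psi>) = \<psi>" if "\<psi> \<in> infons At" for \<psi>
    using that by (induction \<psi>) (auto simp: s_def I_def A_def assms(1))
  have "val I ` \<Gamma> \<subseteq> M"
    using assms(2) by (auto simp: M_def s_val derivable_assumption subset_iff)
  with model have "val I \<phi> \<in> M"
    by (rule valid)
  then show ?thesis
    using assms(3) by (simp add: M_def s_val)
qed

theorem theorem1:
  fixes At :: "'a set" and \<Gamma> :: "'a infon set" and \<phi> :: "'a infon"
  assumes "countable At"
    and "\<Gamma> \<subseteq> infons At"
    and "\<phi> \<in> infons At"
  shows "derivable At \<Gamma> \<phi> \<longleftrightarrow>
    (\<forall>(I :: 'a interp) M. is_model I M \<and> val I ` \<Gamma> \<subseteq> M \<longrightarrow> val I \<phi> \<in> M)"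
  by (rule iffI) (auto intro: soundness completeness[OF assms])

end
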